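(* Let $1<p<\infty$. Then the class $N^p$ is a ring of Nevanlinna--Smirnov type; that is, $N^p$ is a ring with $H^\infty\subset N^p\subset N$, and every $f\in N^p$ can be written in the form $f=g/h$, where $g,h\in H^\infty$ and $h$ is an invertible element of $N^p$.
   Context: $D$ is the open unit disk in $\mathbb{C}$. $H^\infty$ is the ring of bounded holomorphic functions on $D$. The Nevanlinna class $N$ is the set of holomorphic $f$ on $D$ with $\sup_{0<r<1}\int_0^{2\pi}\log^+|f(re^{i\theta})|\,\frac{d\theta}{2\pi}<\infty$, where $\log^+ x=\max(\log x,0)$ for $x\ge 0$ (so $\log^+0=0$). For $1<p<\infty$, the class $N^p$ is the set of holomorphic $f$ on $D$ with $\sup_{0<r<1}\int_0^{2\pi}\big(\log^+|f(re^{i\theta})|\big)^p\,\frac{d\theta}{2\pi}<\infty$. Ring operations are pointwise. A ring $R$ with $H^\infty\subset R\subset N$ is said to be of Nevanlinna--Smirnov type if every $f\in R$ can be written as $g/h$ with $g,h\in H^\infty$ and $h$ invertible in $R$. *)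

theory Defs
  imports "HOL-Analysis.Analysis" "HOL-Algebra.Ring"
begin

abbreviation unit_disk :: "complex set" where
  "unit_disk \<equiv> ball 0 1"

text \<open>
  A function on the disk is represented by its extensional representative, equal to
  \<open>undefined\<close> off the disk. Hence equality in HOL is equality of functions on the disk.
\<close>

definition disk_holomorphic :: "(complex \<Rightarrow> complex) set" where
  "disk_holomorphic = {f \<in> extensional unit_disk. f holomorphic_on unit_disk}"

definition pointwise_ring :: "(complex \<Rightarrow> complex) set \<Rightarrow> (complex \<Rightarrow> complex) ring" where
  "pointwise_ring R =
     \<lparr> carrier = R,
       mult = (\<lambda>f g. \<lambda>z\<in>unit_disk. f z * g z),
       one = (\<lambda>z\<in>unit_disk. 1),
       zero = (\<lambda>z\<in>unit_disk. 0),
       add = (\<lambda>f g. \<lambda>z\<in>unit_disk. f z + g z) \<rparr>"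

definition log_plus :: "real \<Rightarrow> real" where
  "log_plus x = (if x = 0 then 0 else max (ln x) 0)"

definition H_infinity :: "(complex \<Rightarrow> complex) set" where
  "H_infinity = {f \<in> disk_holomorphic. bounded (f ` unit_disk)}"

text \<open>
  The integrands below are continuous in \<open>t\<close> for \<open>f\<close> holomorphic on the disk and
  \<open>0 < r < 1\<close>, so the integrals always exist and finiteness of the supremum is boundedness
  of the set of their values.
\<close>

definition nevanlinna :: "(complex \<Rightarrow> complex) set" where
  "nevanlinna = {f \<in> disk_holomorphic.
     bdd_above ((\<lambda>r. integral {0..2*pi}
       (\<lambda>t. log_plus (cmod (f (of_real r * cis t))) / (2*pi))) ` {0<..<1})}"

definition nevanlinna_p :: "real \<Rightarrow> (complex \<Rightarrow> complex) set" where
  "nevanlinna_p p = {f \<in> disk_holomorphic.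
     bdd_above ((\<lambda>r. integral {0..2*pi}
       (\<lambda>t. log_plus (cmod (f (of_real r * cis t))) powr p / (2*pi))) ` {0<..<1})}"

definition nevanlinna_smirnov_type :: "(complex \<Rightarrow> complex) set \<Rightarrow> bool" where
  "nevanlinna_smirnov_type R \<longleftrightarrow>
     cring (pointwise_ring R) \<and> H_infinity \<subseteq> R \<and> R \<subseteq> nevanlinna \<and>
     (\<forall>f\<in>R. \<exists>g\<in>H_infinity. \<exists>h\<in>H_infinity.
        h \<in> Units (pointwise_ring R) \<and> f = (\<lambda>z\<in>unit_disk. g z / h z))"

end

theory Submission
  imports Defs "HOL-Complex_Analysis.Complex_Analysis" "HOL-Real_Asymp.Real_Asymp"
begin

text \<open>
  The ring properties are soft: \<open>log_plus\<close> is subadditive for products, and subadditive up to a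
  constant for sums, so every inclusion and closure property is a pointwise comparison of the
  functions whose means are bounded (lemma \<open>nevanlinna_p_dominated\<close>).

  The content is the existence of denominators. For \<open>f\<close> in \<open>N\<^sup>p\<close> one wants a holomorphic \<open>G\<close> on the
  disk with \<open>Re G \<ge> log_plus \<bar>f\<bar>\<close> whose real part has bounded \<open>p\<close>-th power means. Then
  \<open>h = exp (- G)\<close> satisfies \<open>\<bar>h\<bar> \<le> 1\<close> and \<open>\<bar>f h\<bar> \<le> 1\<close>, and \<open>log_plus \<bar>1 / h\<bar> = Re G\<close>, so that
  \<open>1 / h\<close> is in \<open>N\<^sup>p\<close> and \<open>f = (f h) / h\<close> is the required quotient. Classically \<open>Re G\<close> is the Poisson
  integral of a weak limit of \<open>log_plus \<bar>f(r \<cdot>)\<bar>\<close>. Here \<open>h\<close> is obtained as a limit of functions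
  \<open>exp (- q)\<close> with \<open>q\<close> a polynomial, which avoids Poisson integrals and boundary values altogether.

  Fix \<open>R < 1\<close>. By the Stone--Weierstrass theorem there is a polynomial \<open>q\<close> whose real part lies on the
  unit circle between \<open>log_plus \<bar>f(R z)\<bar>\<close> and \<open>log_plus \<bar>f(R z)\<bar> + 1\<close>. The maximum principle, applied
  to \<open>f(R z) exp (- q z)\<close> and to \<open>- Re q\<close>, carries the lower bounds into the disk, and
  \<open>power_mean_Re_poly_mono\<close> bounds the power means of \<open>Re q\<close> on all smaller circles
  (lemma \<open>harmonic_polynomial_majorant\<close>). The functions \<open>exp (- q)\<close> obtained for \<open>R \<rightarrow> 1\<close> are bounded by
  \<open>1\<close>, so a subsequence converges locally uniformly (Montel). The mean bound at the centre keeps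
  \<open>\<bar>exp (- q 0)\<bar>\<close> away from \<open>0\<close>, hence by Hurwitz the limit \<open>h\<close> has no zeros, and the power means of
  \<open>- ln \<bar>h\<bar>\<close> are limits of those of \<open>Re q\<close> (lemma \<open>bounded_denominator\<close>).
\<close>

section \<open>The positive logarithm\<close>

lemma log_plus_eq_ln_max: "0 \<le> x \<Longrightarrow> log_plus x = ln (max 1 x)"
  by (auto simp: log_plus_def max_def ln_ge_zero_iff)

lemma log_plus_nonneg: "0 \<le> log_plus x"
  by (simp add: log_plus_def)

lemma log_plus_mono: "0 \<le> x \<Longrightarrow> x \<le> y \<Longrightarrow> log_plus x \<le> log_plus y"
  by (simp add: log_plus_eq_ln_max)

lemma le_exp_log_plus: "0 \<le> x \<Longrightarrow> x \<le> exp (log_plus x)"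
  by (simp add: log_plus_eq_ln_max)

lemma log_plus_mult_le:
  assumes "0 \<le> x" "0 \<le> y"
  shows "log_plus (x * y) \<le> log_plus x + log_plus y"
proof -
  have "max 1 (x * y) \<le> max 1 x * max 1 y"
  proof (rule max.boundedI)
    show "1 \<le> max 1 x * max 1 y"
      using mult_mono[of 1 "max 1 x" 1 "max 1 y"] by simp
    show "x * y \<le> max 1 x * max 1 y"
      using assms by (intro mult_mono) auto
  qed
  then have "ln (max 1 (x * y)) \<le> ln (max 1 x * max 1 y)"
    by (subst ln_le_cancel_iff) (auto simp: less_max_iff_disj intro!: mult_pos_pos)
  then show ?thesis
    using assms by (simp add: log_plus_eq_ln_max ln_mult_pos less_max_iff_disj)
qed

lemma log_plus_add_le:
  assumes "0 \<le> x" "0 \<le> y"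
  shows "log_plus (x + y) \<le> log_plus x + log_plus y + 1"
proof -
  have "log_plus (x + y) \<le> log_plus (2 * max x y)"
    using assms by (intro log_plus_mono) auto
  also have "\<dots> \<le> log_plus 2 + log_plus (max x y)"
    using assms by (intro log_plus_mult_le) auto
  also have "log_plus 2 \<le> 1"
    using ln_2_less_1 by (simp add: log_plus_def)
  also have "log_plus (max x y) \<le> log_plus x + log_plus y"
    using log_plus_nonneg[of x] log_plus_nonneg[of y] by (auto simp: max_def)
  finally show ?thesis by simp
qed

lemma continuous_on_log_plus_powr:
  assumes "continuous_on S g" "\<And>x. x \<in> S \<Longrightarrow> 0 \<le> g x" "0 < p"
  shows "continuous_on S (\<lambda>x. log_plus (g x) powr p)"
proof -
  have "continuous_on S (\<lambda>x. ln (max 1 (g x)) powr p)"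
    by (intro continuous_intros continuous_on_powr' assms ballI)
       (use assms in \<open>auto simp: max_def\<close>)
  then show ?thesis
    by (rule continuous_on_eq) (simp add: log_plus_eq_ln_max assms)
qed

lemma powr_sum3_le:
  fixes a b c p :: real
  assumes "0 \<le> a" "0 \<le> b" "0 \<le> c" "0 < p"
  shows "(a + b + c) powr p \<le> 3 powr p * (a powr p + b powr p + c powr p)"
proof -
  have "(a + b + c) powr p \<le> (3 * max a (max b c)) powr p"
    using assms by (intro powr_mono2) auto
  also have "\<dots> = 3 powr p * max a (max b c) powr p"
    using assms by (subst powr_mult) auto
  also have "\<dots> \<le> 3 powr p * (a powr p + b powr p + c powr p)"
    by (intro mult_left_mono) (auto simp: max_def)
  finally show ?thesis .
qed

section \<open>Rings of holomorphic functions with bounded logarithmic means\<close>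

lemma continuous_on_circle_log_plus:
  assumes "f holomorphic_on unit_disk" "0 \<le> r" "r < 1" "0 < p"
  shows "continuous_on A (\<lambda>t. log_plus (cmod (f (of_real r * cis t))) powr p)"
proof (rule continuous_on_log_plus_powr)
  have "continuous_on A (\<lambda>t. f (of_real r * cis t))"
    using assms
    by (intro continuous_on_compose2[OF holomorphic_on_imp_continuous_on[OF assms(1)]])
       (auto intro!: continuous_intros simp: norm_mult)
  then show "continuous_on A (\<lambda>t. cmod (f (of_real r * cis t)))"
    by (rule continuous_on_norm)
qed (use assms in auto)

lemma nevanlinna_p_iff:
  "f \<in> nevanlinna_p p \<longleftrightarrow> f \<in> disk_holomorphic \<and>
     (\<exists>C. \<forall>r. 0 < r \<and> r < 1 \<longrightarrow>
        integral {0..2*pi} (\<lambda>t. log_plus (cmod (f (of_real r * cis t))) powr p) \<le> C)"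
proof -
  define I where "I = (\<lambda>r. integral {0..2*pi} (\<lambda>t. log_plus (cmod (f (of_real r * cis t))) powr p))"
  have "bdd_above ((\<lambda>r. I r / (2 * pi)) ` {0<..<1}) \<longleftrightarrow> (\<exists>C. \<forall>r. 0 < r \<and> r < 1 \<longrightarrow> I r \<le> C)"
    (is "?bdd \<longleftrightarrow> ?bound")
  proof
    assume ?bdd
    then obtain C where "\<And>r. 0 < r \<Longrightarrow> r < 1 \<Longrightarrow> I r / (2 * pi) \<le> C"
      unfolding bdd_above_def by (metis greaterThanLessThan_iff imageI)
    then have "\<And>r. 0 < r \<Longrightarrow> r < 1 \<Longrightarrow> I r \<le> C * (2 * pi)"
      by (simp add: pos_divide_le_eq)
    then show ?bound by blast
  next
    assume ?bound
    then obtain C where "\<And>r. 0 < r \<Longrightarrow> r < 1 \<Longrightarrow> I r \<le> C" by blast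
    then show ?bdd
      by (intro bdd_aboveI2[where M = "C / (2 * pi)"] divide_right_mono) auto
  qed
  then show ?thesis
    by (simp add: nevanlinna_p_def I_def)
qed

lemma nevanlinna_eq_nevanlinna_p_1: "nevanlinna = nevanlinna_p 1"
  by (simp add: nevanlinna_def nevanlinna_p_def log_plus_nonneg)

text \<open>
  Integrating the pointwise estimate over each circle bounds the means of \<open>f\<close> by those of \<open>g\<close> and \<open>h\<close>.
  Two comparison functions serve sums and products; two exponents serve the inclusion into the
  Nevanlinna class, which is the case of exponent \<open>1\<close>.
\<close>
lemma nevanlinna_p_dominated:
  assumes f: "f \<in> disk_holomorphic" and g: "g \<in> nevanlinna_p p" and h: "h \<in> nevanlinna_p p"
    and "0 < p" "0 < q" "0 \<le> A"
    and le: "\<And>z. z \<in> unit_disk \<Longrightarrow> log_plus (cmod (f z)) powr q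
          \<le> A * (log_plus (cmod (g z)) powr p + log_plus (cmod (h z)) powr p + 1)"
  shows "f \<in> nevanlinna_p q"
proof -
  define I where "I = (\<lambda>k s r. integral {0..2*pi} (\<lambda>t. log_plus (cmod (k (of_real r * cis t))) powr s))"
  obtain C D where C: "\<And>r. 0 < r \<Longrightarrow> r < 1 \<Longrightarrow> I g p r \<le> C"
    and D: "\<And>r. 0 < r \<Longrightarrow> r < 1 \<Longrightarrow> I h p r \<le> D"
    using g h unfolding nevanlinna_p_iff I_def by metis
  have hol: "f holomorphic_on unit_disk" "g holomorphic_on unit_disk" "h holomorphic_on unit_disk"
    using f g h by (auto simp: nevanlinna_p_iff disk_holomorphic_def)
  have "I f q r \<le> A * (C + D + 2 * pi)" if r: "0 < r" "r < 1" for r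
  proof -
    have int: "(\<lambda>t. log_plus (cmod (k (of_real r * cis t))) powr s) integrable_on {0..2*pi}"
      if "k holomorphic_on unit_disk" "0 < s" for k s
      using that r by (intro integrable_continuous_interval continuous_on_circle_log_plus) auto
    have "I f q r \<le> integral {0..2*pi} (\<lambda>t. A * (log_plus (cmod (g (of_real r * cis t))) powr p
           + log_plus (cmod (h (of_real r * cis t))) powr p + 1))"
      unfolding I_def
      by (intro integral_le le integrable_on_mult_right integrable_add int hol assms)
         (use r in \<open>auto simp: norm_mult\<close>)
    also have "\<dots> = A * (I g p r + I h p r + 2 * pi)"
      unfolding I_def
      by (simp add: integral_add[OF integrable_add[OF int[OF hol(2) \<open>0 < p\<close>] int[OF hol(3) \<open>0 < p\<close>]] integrable_const_ivl]
            integral_add[OF int[OF hol(2) \<open>0 < p\<close>] int[OF hol(3) \<open>0 < p\<close>]])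
    also have "\<dots> \<le> A * (C + D + 2 * pi)"
      using C[OF r] D[OF r] \<open>0 \<le> A\<close> by (intro mult_left_mono) auto
    finally show ?thesis .
  qed
  then show ?thesis
    using f unfolding nevanlinna_p_iff I_def by blast
qed

lemma disk_holomorphic_restrict:
  "f holomorphic_on unit_disk \<Longrightarrow> (\<lambda>z\<in>unit_disk. f z) \<in> disk_holomorphic"
  by (auto simp: disk_holomorphic_def intro: holomorphic_transform)

lemma zero_in_nevanlinna_p: "(\<lambda>z\<in>unit_disk. 0) \<in> nevanlinna_p p"
proof -
  have "integral {0..2*pi} (\<lambda>t. log_plus (cmod ((\<lambda>z\<in>unit_disk. 0) (of_real r * cis t))) powr p) = 0"
    if "0 < r" "r < 1" for r :: real
    using that by (simp add: norm_mult log_plus_def)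
  then show ?thesis
    unfolding nevanlinna_p_iff by (auto intro!: disk_holomorphic_restrict exI[of _ 0] simp del: restrict_apply)
qed

lemma H_infinity_subset_nevanlinna_p:
  assumes "0 < p"
  shows "H_infinity \<subseteq> nevanlinna_p p"
proof
  fix f assume f: "f \<in> H_infinity"
  then obtain B where B: "\<And>z. z \<in> unit_disk \<Longrightarrow> cmod (f z) \<le> B"
    unfolding H_infinity_def bounded_iff by blast
  show "f \<in> nevanlinna_p p"
  proof (rule nevanlinna_p_dominated[OF _ zero_in_nevanlinna_p[of p] zero_in_nevanlinna_p[of p],
        where A = "log_plus B powr p"])
    show "f \<in> disk_holomorphic" using f by (simp add: H_infinity_def)
    fix z assume "z \<in> unit_disk"
    with B have "log_plus (cmod (f z)) powr p \<le> log_plus B powr p"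
      using assms by (intro powr_mono2 log_plus_mono) (auto simp: log_plus_nonneg)
    then show "log_plus (cmod (f z)) powr p \<le> log_plus B powr p *
        (log_plus (cmod ((\<lambda>z\<in>unit_disk. 0) z)) powr p
         + log_plus (cmod ((\<lambda>z\<in>unit_disk. 0) z)) powr p + 1)"
      using \<open>z \<in> unit_disk\<close> by (simp add: log_plus_def)
  qed (use assms in auto)
qed

lemma nevanlinna_p_antimono:
  assumes "0 < q" "q \<le> p"
  shows "nevanlinna_p p \<subseteq> nevanlinna_p q"
proof
  fix f assume f: "f \<in> nevanlinna_p p"
  show "f \<in> nevanlinna_p q"
  proof (rule nevanlinna_p_dominated[OF _ f f, where A = 1])
    show "f \<in> disk_holomorphic" using f by (simp add: nevanlinna_p_iff)
    fix z :: complex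
    define x where "x = log_plus (cmod (f z))"
    have "x powr q \<le> x powr p + 1"
    proof (cases "x \<le> 1")
      case True
      then have "x powr q \<le> 1"
        using assms powr_mono2[of q x 1] by (simp add: x_def log_plus_nonneg)
      then show ?thesis by (simp add: add_increasing)
    next
      case False
      then show ?thesis
        using assms powr_mono[of q p x] by linarith
    qed
    also have "\<dots> \<le> x powr p + x powr p + 1" by simp
    finally show "log_plus (cmod (f z)) powr q
        \<le> 1 * (log_plus (cmod (f z)) powr p + log_plus (cmod (f z)) powr p + 1)"
      by (simp add: x_def)
  qed (use assms in auto)
qed

lemma nevanlinna_p_of_log_plus_le:
  assumes "0 < p" and f: "f \<in> nevanlinna_p p" and g: "g \<in> nevanlinna_p p"
    and k: "k holomorphic_on unit_disk"
    and le: "\<And>z. z \<in> unit_disk \<Longrightarrow>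
           log_plus (cmod (k z)) \<le> log_plus (cmod (f z)) + log_plus (cmod (g z)) + 1"
  shows "(\<lambda>z\<in>unit_disk. k z) \<in> nevanlinna_p p"
proof (rule nevanlinna_p_dominated[OF _ f g, where A = "3 powr p"])
  show "(\<lambda>z\<in>unit_disk. k z) \<in> disk_holomorphic"
    by (rule disk_holomorphic_restrict[OF k])
  fix z assume z: "z \<in> unit_disk"
  have "log_plus (cmod (k z)) powr p \<le> (log_plus (cmod (f z)) + log_plus (cmod (g z)) + 1) powr p"
    using le[OF z] \<open>0 < p\<close> by (intro powr_mono2) (auto simp: log_plus_nonneg)
  also have "\<dots> \<le> 3 powr p * (log_plus (cmod (f z)) powr p + log_plus (cmod (g z)) powr p + 1 powr p)"
    using \<open>0 < p\<close> by (intro powr_sum3_le) (auto simp: log_plus_nonneg)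
  finally show "log_plus (cmod ((\<lambda>z\<in>unit_disk. k z) z)) powr p
      \<le> 3 powr p * (log_plus (cmod (f z)) powr p + log_plus (cmod (g z)) powr p + 1)"
    using z by simp
qed (use assms in auto)

lemma nevanlinna_p_add:
  assumes "0 < p" "f \<in> nevanlinna_p p" "g \<in> nevanlinna_p p"
  shows "(\<lambda>z\<in>unit_disk. f z + g z) \<in> nevanlinna_p p"
proof (rule nevanlinna_p_of_log_plus_le[OF assms])
  show "(\<lambda>z. f z + g z) holomorphic_on unit_disk"
    using assms by (auto simp: nevanlinna_p_iff disk_holomorphic_def intro!: holomorphic_intros)
  fix z
  have "log_plus (cmod (f z + g z)) \<le> log_plus (cmod (f z) + cmod (g z))"
    by (intro log_plus_mono norm_triangle_ineq) auto
  also have "\<dots> \<le> log_plus (cmod (f z)) + log_plus (cmod (g z)) + 1"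
    by (intro log_plus_add_le) auto
  finally show "log_plus (cmod (f z + g z)) \<le> log_plus (cmod (f z)) + log_plus (cmod (g z)) + 1" .
qed

lemma nevanlinna_p_mult:
  assumes "0 < p" "f \<in> nevanlinna_p p" "g \<in> nevanlinna_p p"
  shows "(\<lambda>z\<in>unit_disk. f z * g z) \<in> nevanlinna_p p"
proof (rule nevanlinna_p_of_log_plus_le[OF assms])
  show "(\<lambda>z. f z * g z) holomorphic_on unit_disk"
    using assms by (auto simp: nevanlinna_p_iff disk_holomorphic_def intro!: holomorphic_intros)
  fix z
  show "log_plus (cmod (f z * g z)) \<le> log_plus (cmod (f z)) + log_plus (cmod (g z)) + 1"
    using log_plus_mult_le[of "cmod (f z)" "cmod (g z)"] by (simp add: norm_mult)
qed

lemma const_in_H_infinity: "(\<lambda>z\<in>unit_disk. c) \<in> H_infinity"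
  unfolding H_infinity_def
  by (auto intro!: disk_holomorphic_restrict boundedI[of _ "cmod c"])

lemma extensional_restrict_eq: "f \<in> extensional A \<Longrightarrow> (\<And>x. x \<in> A \<Longrightarrow> g x = f x) \<Longrightarrow> (\<lambda>x\<in>A. g x) = f"
  by (auto simp: extensional_def)

lemma cring_nevanlinna_p:
  assumes "0 < p"
  shows "cring (pointwise_ring (nevanlinna_p p))"
proof (rule cringI)
  have ext: "f \<in> extensional unit_disk" if "f \<in> nevanlinna_p p" for f
    using that by (simp add: nevanlinna_p_iff disk_holomorphic_def)
  have const: "(\<lambda>z\<in>unit_disk. c) \<in> nevanlinna_p p" for c
    using const_in_H_infinity H_infinity_subset_nevanlinna_p[OF assms] by blast
  have neg: "\<exists>g\<in>nevanlinna_p p. (\<lambda>z\<in>unit_disk. f z + g z) = (\<lambda>z\<in>unit_disk. 0)"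
    if "f \<in> nevanlinna_p p" for f
    by (rule bexI[OF _ nevanlinna_p_mult[OF assms const[of "-1"] that]])
       (auto intro!: restrict_ext)
  show "abelian_group (pointwise_ring (nevanlinna_p p))"
    by (rule abelian_groupI)
       (auto simp: pointwise_ring_def nevanlinna_p_add assms const neg add_ac ext
             intro!: restrict_ext extensional_restrict_eq)
  show "comm_monoid (pointwise_ring (nevanlinna_p p))"
    by (rule comm_monoidI)
       (auto simp: pointwise_ring_def nevanlinna_p_mult assms const mult_ac ext
             intro!: restrict_ext extensional_restrict_eq)
qed (auto simp: pointwise_ring_def distrib_right intro!: restrict_ext)

section \<open>Trigonometric polynomials on the unit circle\<close>

text \<open>
  On the unit circle \<open>z * cnj z = 1\<close>, so \<open>z\<^sup>m * cnj z\<^sup>n\<close> is a power of \<open>z\<close> or of \<open>cnj z\<close>, and the real part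
  does not change when \<open>cnj z\<close> is replaced by \<open>z\<close> and the coefficient is conjugated. The
  induction removes one factor \<open>z * cnj z\<close> at a time from the product of the tails.
\<close>
lemma Re_poly_mult_cnj_poly_on_circle:
  fixes q1 q2 :: "complex poly"
  shows "\<exists>q. \<forall>z\<in>sphere 0 1. Re (poly q1 z * cnj (poly q2 z)) = Re (poly q z)"
proof (induction q1 q2 rule: poly_induct2)
  case 0
  show ?case by (auto intro: exI[of _ 0])
next
  case (pCons a A b B)
  then obtain q where q: "\<And>z. z \<in> sphere 0 1 \<Longrightarrow> Re (poly A z * cnj (poly B z)) = Re (poly q z)"
    by blast
  have Re_swap: "Re (v * cnj w) = Re (cnj v * w)" for v w
    by simp
  show ?case
  proof (intro exI[of _ "pCons (a * cnj b) (smult (cnj a) B + smult (cnj b) A) + q"] ballI)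
    fix z :: complex assume z: "z \<in> sphere 0 1"
    then have "z * cnj z = 1"
      by (simp add: complex_norm_square[symmetric])
    then have "poly (pCons a A) z * cnj (poly (pCons b B) z)
        = a * cnj b + a * cnj (z * poly B z) + cnj b * (z * poly A z) + poly A z * cnj (poly B z)"
      by (simp add: algebra_simps)
    then have "Re (poly (pCons a A) z * cnj (poly (pCons b B) z))
        = Re (a * cnj b) + Re (a * cnj (z * poly B z)) + Re (cnj b * (z * poly A z))
          + Re (poly A z * cnj (poly B z))"
      by (simp only: plus_complex.sel)
    also have "\<dots> = Re (a * cnj b) + Re (cnj a * (z * poly B z)) + Re (cnj b * (z * poly A z))
          + Re (poly q z)"
      using Re_swap[of a "z * poly B z"] q[OF z] by (simp only:)
    also have "\<dots> = Re (a * cnj b + cnj a * (z * poly B z) + cnj b * (z * poly A z) + poly q z)"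
      by (simp only: plus_complex.sel)
    also have "\<dots> = Re (poly (pCons (a * cnj b) (smult (cnj a) B + smult (cnj b) A) + q) z)"
      by (rule arg_cong[where f = Re]) (simp add: algebra_simps)
    finally show "Re (poly (pCons a A) z * cnj (poly (pCons b B) z))
        = Re (poly (pCons (a * cnj b) (smult (cnj a) B + smult (cnj b) A) + q) z)" .
  qed
qed

text \<open>
  This uses \<open>2 * Re a * Re b = Re (a * b) + Re (a * cnj b)\<close>.
\<close>
lemma Re_poly_mult_Re_poly_on_circle:
  fixes q1 q2 :: "complex poly"
  shows "\<exists>q. \<forall>z\<in>sphere 0 1. Re (poly q1 z) * Re (poly q2 z) = Re (poly q z)"
proof -
  obtain q where q: "\<And>z. z \<in> sphere 0 1 \<Longrightarrow> Re (poly q1 z * cnj (poly q2 z)) = Re (poly q z)"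
    using Re_poly_mult_cnj_poly_on_circle by blast
  have "Re (poly q1 z) * Re (poly q2 z) = Re (poly (smult (1/2) (q1 * q2 + q)) z)"
    if "z \<in> sphere 0 1" for z
    using q[OF that, symmetric] by simp
  then show ?thesis by blast
qed

text \<open>
  The restrictions to the circle of the real parts of polynomials form an algebra by the previous
  lemma, and \<open>Re\<close> and \<open>Im\<close> already separate points, so the Stone--Weierstrass theorem applies.
\<close>
lemma Re_poly_dense_on_circle:
  fixes \<phi> :: "complex \<Rightarrow> real"
  assumes "continuous_on (sphere 0 1) \<phi>" "0 < e"
  shows "\<exists>q. \<forall>z\<in>sphere 0 1. \<bar>\<phi> z - Re (poly q z)\<bar> < e"
proof -
  define P where "P = (\<lambda>u. \<exists>q::complex poly. \<forall>z\<in>sphere 0 1. u z = Re (poly q z))"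
  have "\<exists>u. P u \<and> (\<forall>z\<in>sphere 0 1. \<bar>\<phi> z - u z\<bar> < e)"
  proof (rule Stone_Weierstrass_HOL[OF _ _ _ _ _ _ assms])
    show "P (\<lambda>z. c)" for c
      unfolding P_def by (intro exI[of _ "[:of_real c:]"]) simp
    show "continuous_on (sphere 0 1) u" if Pu: "P u" for u
    proof -
      obtain q :: "complex poly" where q: "\<And>z. z \<in> sphere 0 1 \<Longrightarrow> u z = Re (poly q z)"
        using Pu unfolding P_def by blast
      have "continuous_on (sphere 0 1) (\<lambda>z. Re (poly q z))"
        by (intro continuous_intros)
      then show ?thesis
        by (rule continuous_on_eq) (simp add: q)
    qed
    show "P (\<lambda>z. u z + v z)" if uv: "P u \<and> P v" for u v
    proof -
      obtain q1 where q1: "\<forall>z\<in>sphere 0 1. u z = Re (poly q1 z)"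
        using uv unfolding P_def by blast
      obtain q2 where q2: "\<forall>z\<in>sphere 0 1. v z = Re (poly q2 z)"
        using uv unfolding P_def by blast
      show ?thesis
        unfolding P_def by (rule exI[of _ "q1 + q2"]) (simp add: q1 q2)
    qed
    show "P (\<lambda>z. u z * v z)" if uv: "P u \<and> P v" for u v
    proof -
      obtain q1 where q1: "\<forall>z\<in>sphere 0 1. u z = Re (poly q1 z)"
        using uv unfolding P_def by blast
      obtain q2 where q2: "\<forall>z\<in>sphere 0 1. v z = Re (poly q2 z)"
        using uv unfolding P_def by blast
      obtain q where "\<forall>z\<in>sphere 0 1. Re (poly q1 z) * Re (poly q2 z) = Re (poly q z)"
        using Re_poly_mult_Re_poly_on_circle by blast
      then show ?thesis
        unfolding P_def by (intro exI[of _ q]) (simp add: q1 q2)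
    qed
    show "\<exists>u. P u \<and> u x \<noteq> u y" if "x \<in> sphere 0 1 \<and> y \<in> sphere 0 1 \<and> x \<noteq> y" for x y
    proof (cases "Re x = Re y")
      case True
      have "P Im"
        unfolding P_def by (intro exI[of _ "[:0, -\<i>:]"]) simp
      moreover have "Im x \<noteq> Im y" using True that by (simp add: complex_eq_iff)
      ultimately show ?thesis by blast
    next
      case False
      have "P Re"
        unfolding P_def by (intro exI[of _ "[:0, 1:]"]) simp
      then show ?thesis using False by blast
    qed
  qed simp
  then obtain u q where "\<forall>z\<in>sphere 0 1. u z = Re (poly q z)" "\<forall>z\<in>sphere 0 1. \<bar>\<phi> z - u z\<bar> < e"
    unfolding P_def by blast
  then show ?thesis
    by (intro exI[of _ q]) simp
qed

section \<open>Power means of positive harmonic polynomials\<close>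

lemma powr_above_tangent:
  fixes a x p :: real
  assumes "0 \<le> a" "0 \<le> x" "1 < p"
  shows "a powr p + p * a powr (p - 1) * (x - a) \<le> x powr p"
proof -
  consider "a = 0" | "0 < a" "x = 0" | "0 < a" "0 < x" using assms by linarith
  then show ?thesis
  proof cases
    case 2
    then have "a powr p = a powr (p - 1) * a"
      using powr_add[of a "p - 1" 1] by simp
    then show ?thesis
      using 2 assms by (simp add: mult_right_mono)
  next
    case 3
    have "((\<lambda>x. x powr p) has_real_derivative p * a powr (p - 1)) (at a within {0<..})"
      by (rule has_field_derivative_at_within[OF has_real_derivative_powr[OF 3(1)]])
    moreover have "convex_on {0<..} (\<lambda>x. x powr p)"
      using assms by (intro powr_convex) simp
    moreover have "a \<in> interior {0<..}"
      using 3 by (simp add: interior_open)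
    moreover have "x \<in> {0<..}"
      using 3 by simp
    ultimately have "p * a powr (p - 1) * (x - a) \<le> x powr p - a powr p"
      by (intro convex_on_imp_above_tangent[OF _ connected_Ioi])
    then show ?thesis by linarith
  qed (use assms in simp)
qed

lemma integral_circle_rotate:
  fixes F :: "complex \<Rightarrow> real"
  assumes F: "continuous_on (sphere 0 1) F" and u: "cmod u = 1"
  shows "integral {0..2*pi} (\<lambda>t. F (u * cis t)) = integral {0..2*pi} (\<lambda>t. F (cis t))"
proof -
  define G where "G = (\<lambda>t. F (cis t))"
  define c where "c = Arg2pi u"
  have uc: "u = cis c" and c: "0 \<le> c" "c \<le> 2 * pi"
    using Arg2pi[of u] u by (auto simp: c_def cis_conv_exp is_Arg_def)
  have per: "G (t + 2 * pi) = G t" for t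
    by (simp add: G_def cis.ctr)
  have int: "G integrable_on {a..b}" for a b
    unfolding G_def
    by (intro integrable_continuous_interval continuous_on_compose2[OF F] continuous_intros) auto
  have "integral {0..2*pi} (\<lambda>t. F (u * cis t)) = integral {0..2*pi} (G \<circ> (+) c)"
    by (simp add: G_def uc cis_mult o_def)
  also have "\<dots> = integral {c..2*pi+c} G"
    using integral_shift_Icc_real[of 0 "2*pi" G c] by simp
  also have "\<dots> = integral {c..2*pi} G + integral {2*pi..2*pi+c} G"
    using c by (intro Henstock_Kurzweil_Integration.integral_combine[symmetric] int) auto
  also have "integral {2*pi..2*pi+c} G = integral {0..c} (G \<circ> (+) (2*pi))"
    using integral_shift_Icc_real[of 0 c G "2*pi"] by (simp only: add_0 add.commute)
  also have "G \<circ> (+) (2*pi) = G"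
    by (rule ext) (simp only: o_def per add.commute[of "2*pi"])
  also have "integral {c..2*pi} G + integral {0..c} G = integral {0..2*pi} G"
    using Henstock_Kurzweil_Integration.integral_combine[OF c int] by (simp only: add.commute)
  finally show ?thesis by (simp add: G_def)
qed

text \<open>
  Averaging rotations of \<open>q\<close> multiplies each coefficient by a Fourier coefficient of the weight. In
  the induction the factor \<open>cis t\<close> split off from \<open>q\<close> is absorbed into the weight, which is why the
  weight is complex-valued.
\<close>
lemma weighted_rotation_average_is_poly:
  fixes q :: "complex poly" and w :: "real \<Rightarrow> complex"
  assumes "continuous_on {a..b} w"
  shows "\<exists>Q. \<forall>z. poly Q z = integral {a..b} (\<lambda>t. w t * poly q (z * cis t))"
  using assms
proof (induction q arbitrary: w)
  case 0
  show ?case by (auto intro: exI[of _ 0])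
next
  case (pCons c q)
  have "continuous_on {a..b} (\<lambda>t. w t * cis t)"
    by (intro continuous_intros pCons.prems)
  from pCons.IH[OF this] obtain Q
    where Q: "\<And>z. poly Q z = integral {a..b} (\<lambda>t. w t * cis t * poly q (z * cis t))" by blast
  show ?case
  proof (intro exI[of _ "pCons (c * integral {a..b} w) Q"] allI)
    fix z
    have "(\<lambda>t. c * w t) integrable_on {a..b}"
      "(\<lambda>t. z * (w t * cis t * poly q (z * cis t))) integrable_on {a..b}"
      by (intro integrable_continuous_interval continuous_intros pCons.prems)+
    from integral_add[OF this]
    show "poly (pCons (c * integral {a..b} w) Q) z
        = integral {a..b} (\<lambda>t. w t * poly (pCons c q) (z * cis t))"
      by (simp add: Q algebra_simps)
  qed
qed

text \<open>
  A duality argument. Let \<open>a(t)\<close> be the values of \<open>Re q\<close> on the small circle. Convexity gives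
  \<open>x\<^sup>p \<ge> a\<^sup>p + w (x - a)\<close> with slope \<open>w = p a\<^sup>p\<^sup>-\<^sup>1\<close>. Take for \<open>x\<close> the values of \<open>Re q\<close> on the unit
  circle rotated by some \<open>u\<close>, and integrate: the linear term becomes \<open>Re Q(u) - Re Q(r)\<close>, where
  \<open>Q(z) = \<integral> w(t) q(z cis t) dt\<close> is a polynomial. By the maximum principle some \<open>u\<close> on the circle makes
  this difference nonnegative, and the integral over the unit circle is rotation invariant.
\<close>
lemma power_mean_Re_poly_mono:
  fixes q :: "complex poly"
  assumes "1 < p" and r: "0 \<le> r" "r \<le> 1"
    and pos: "\<And>z. cmod z \<le> 1 \<Longrightarrow> 0 \<le> Re (poly q z)"
  shows "integral {0..2*pi} (\<lambda>t. Re (poly q (of_real r * cis t)) powr p)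
       \<le> integral {0..2*pi} (\<lambda>t. Re (poly q (cis t)) powr p)"
proof -
  define a where "a = (\<lambda>t. Re (poly q (of_real r * cis t)))"
  define w where "w = (\<lambda>t. p * a t powr (p - 1))"
  have a_nonneg: "0 \<le> a t" for t
    unfolding a_def using r by (intro pos) (simp add: norm_mult)
  have cont_a: "continuous_on A a" for A
    unfolding a_def by (intro continuous_intros)
  have cont_powr: "continuous_on A (\<lambda>t. a t powr s)" if "0 < s" for s A
    using that a_nonneg by (intro continuous_on_powr' cont_a continuous_intros) auto
  have cont_w: "continuous_on A w" for A
    unfolding w_def using \<open>1 < p\<close> by (intro continuous_intros cont_powr) auto
  obtain Q where Q: "\<And>z. poly Q z = integral {0..2*pi} (\<lambda>t. of_real (w t) * poly q (z * cis t))"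
    using weighted_rotation_average_is_poly[of 0 "2*pi" "\<lambda>t. of_real (w t)" q]
    by (auto intro!: continuous_intros cont_w)
  have ReQ: "Re (poly Q z) = integral {0..2*pi} (\<lambda>t. w t * Re (poly q (z * cis t)))" for z
  proof -
    have "(\<lambda>t. of_real (w t) * poly q (z * cis t)) integrable_on {0..2*pi}"
      by (intro integrable_continuous_interval continuous_intros cont_w)
    from integral_linear[OF this bounded_linear_Re] show ?thesis
      by (simp add: Q o_def)
  qed
  \<comment> \<open>The rotation for which the linear term of the tangent inequality has the right sign.\<close>
  have "\<exists>u\<in>sphere 0 1. \<forall>z\<in>sphere 0 (1::real). Re (poly Q z) \<le> Re (poly Q u)"
    by (intro continuous_attains_sup continuous_intros) auto
  then obtain u where u: "cmod u = 1" and max: "\<And>z. cmod z = 1 \<Longrightarrow> Re (poly Q z) \<le> Re (poly Q u)"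
    by auto
  have Q_le: "Re (poly Q (of_real r)) \<le> Re (poly Q u)"
    by (rule maximum_real_frontier[where S = "cball 0 1"])
       (use r max in \<open>auto intro!: holomorphic_intros continuous_intros\<close>)
  have cont_u: "continuous_on A (\<lambda>t. Re (poly q (u * cis t)))" for A
    by (intro continuous_intros)
  have pos_u: "0 \<le> Re (poly q (u * cis t))" for t
    using u by (intro pos) (simp add: norm_mult)
  have int: "(\<lambda>t. a t powr p) integrable_on {0..2*pi}"
    "(\<lambda>t. w t * Re (poly q (u * cis t))) integrable_on {0..2*pi}"
    "(\<lambda>t. w t * a t) integrable_on {0..2*pi}"
    using \<open>1 < p\<close>
    by (intro integrable_continuous_interval continuous_intros cont_a cont_w cont_u cont_powr; simp)+
  have "integral {0..2*pi} (\<lambda>t. a t powr p)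
      \<le> integral {0..2*pi} (\<lambda>t. a t powr p) + (Re (poly Q u) - Re (poly Q (of_real r)))"
    using Q_le by simp
  also have "\<dots> = integral {0..2*pi} (\<lambda>t. a t powr p + (w t * Re (poly q (u * cis t)) - w t * a t))"
    by (subst integral_add[OF int(1) integrable_diff[OF int(2,3)]], subst integral_diff[OF int(2,3)])
       (simp add: ReQ a_def)
  also have "\<dots> \<le> integral {0..2*pi} (\<lambda>t. Re (poly q (u * cis t)) powr p)"
  proof (rule integral_le)
    show "(\<lambda>t. a t powr p + (w t * Re (poly q (u * cis t)) - w t * a t)) integrable_on {0..2*pi}"
      by (intro integrable_add integrable_diff int)
    show "(\<lambda>t. Re (poly q (u * cis t)) powr p) integrable_on {0..2*pi}"
      using pos_u \<open>1 < p\<close>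
      by (intro integrable_continuous_interval continuous_on_powr' cont_u continuous_intros) auto
    show "a t powr p + (w t * Re (poly q (u * cis t)) - w t * a t) \<le> Re (poly q (u * cis t)) powr p" for t
      using powr_above_tangent[OF a_nonneg pos_u \<open>1 < p\<close>, of t t] by (simp add: w_def algebra_simps)
  qed
  also have "\<dots> = integral {0..2*pi} (\<lambda>t. Re (poly q (cis t)) powr p)"
  proof (rule integral_circle_rotate[OF _ u])
    show "continuous_on (sphere 0 1) (\<lambda>z. Re (poly q z) powr p)"
      using pos \<open>1 < p\<close> by (intro continuous_on_powr' continuous_intros) auto
  qed
  finally show ?thesis by (simp add: a_def)
qed

section \<open>Denominators\<close>

text \<open>
  A trigonometric polynomial within one unit above \<open>log_plus \<bar>f(R z)\<bar>\<close> on the unit circle takes the place of a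
  harmonic majorant. The subharmonicity of \<open>ln \<bar>f\<bar>\<close> enters only through the maximum modulus
  principle for \<open>f(R z) exp (- q z)\<close>. Any fixed upper bound on the gap suffices: it only affects the
  constant in the bound for the means.
\<close>
lemma harmonic_polynomial_majorant:
  assumes f: "f holomorphic_on unit_disk" and R: "0 < R" "R < 1" and p: "1 < p"
  obtains q :: "complex poly"
  where "\<And>z. cmod z \<le> 1 \<Longrightarrow> 0 \<le> Re (poly q z)"
    and "\<And>z. cmod z \<le> 1 \<Longrightarrow> cmod (f (of_real R * z) * exp (- poly q z)) \<le> 1"
    and "\<And>r. 0 \<le> r \<Longrightarrow> r \<le> 1 \<Longrightarrow>
          integral {0..2*pi} (\<lambda>t. Re (poly q (of_real r * cis t)) powr p)
          \<le> 3 powr p * (integral {0..2*pi} (\<lambda>t. log_plus (cmod (f (of_real R * cis t))) powr p) + 2 * pi)"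
proof -
  define F where "F = (\<lambda>z. f (of_real R * z))"
  have in_disk: "of_real R * z \<in> unit_disk" if "cmod z \<le> 1" for z
  proof -
    have "R * cmod z < 1"
      using mult_left_mono[OF that, of R] R by linarith
    then show ?thesis using R by (simp add: norm_mult)
  qed
  have contF: "continuous_on (cball 0 1) F"
    unfolding F_def
    by (intro continuous_on_compose2[OF holomorphic_on_imp_continuous_on[OF f]] continuous_intros)
       (use in_disk in auto)
  have holF: "F holomorphic_on ball 0 1"
    unfolding F_def
    by (intro holomorphic_on_compose_gen[OF _ f, unfolded o_def] holomorphic_intros)
       (use in_disk in auto)
  have "continuous_on (sphere 0 1) (\<lambda>z. log_plus (cmod (F z)) powr 1)"
    by (intro continuous_on_log_plus_powr continuous_on_norm continuous_on_subset[OF contF]) auto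
  then have "continuous_on (sphere 0 1) (\<lambda>z. log_plus (cmod (F z)) + 1 / 2)"
    by (intro continuous_intros) (simp add: log_plus_nonneg)
  \<comment> \<open>Aiming half a unit above the target with error below one half leaves \<open>Re q\<close> above it.\<close>
  from Re_poly_dense_on_circle[OF this, of "1/2"] obtain q where
    q: "\<And>z. cmod z = 1 \<Longrightarrow> \<bar>log_plus (cmod (F z)) + 1 / 2 - Re (poly q z)\<bar> < 1 / 2"
    by (metis dist_0_norm mem_sphere half_gt_zero_iff zero_less_one)
  have lower: "log_plus (cmod (F z)) \<le> Re (poly q z)"
    and upper: "Re (poly q z) \<le> log_plus (cmod (F z)) + 1" if "cmod z = 1" for z
    using q[OF that] by (auto simp: abs_if split: if_splits)
  have pos: "0 \<le> Re (poly q z)" if "cmod z \<le> 1" for z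
  proof -
    have "Re (- poly q z) \<le> 0"
    proof (rule maximum_real_frontier[where S = "cball 0 1" and f = "\<lambda>w. - poly q w"])
      fix w :: complex assume "w \<in> frontier (cball 0 1)"
      then show "Re (- poly q w) \<le> 0"
        using lower[of w] log_plus_nonneg[of "cmod (F w)"] by simp
    qed (use that in \<open>auto intro!: holomorphic_intros continuous_intros\<close>)
    then show ?thesis by simp
  qed
  have bd: "cmod (F z * exp (- poly q z)) \<le> 1" if "cmod z \<le> 1" for z
  proof (rule maximum_modulus_frontier[where S = "cball 0 1"
        and f = "\<lambda>w. F w * exp (- poly q w)"])
    fix w :: complex assume "w \<in> frontier (cball 0 1)"
    then have w: "cmod w = 1" by simp
    have "cmod (F w) \<le> exp (log_plus (cmod (F w)))"
      by (intro le_exp_log_plus) auto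
    also have "\<dots> \<le> exp (Re (poly q w))" using lower[OF w] by simp
    finally show "cmod (F w * exp (- poly q w)) \<le> 1"
      by (simp add: norm_mult norm_divide exp_minus field_simps)
  qed (use that holF contF in \<open>auto intro!: holomorphic_intros continuous_intros\<close>)
  have int: "(\<lambda>t. log_plus (cmod (F (cis t))) powr p) integrable_on {0..2*pi}"
    unfolding F_def using R p f
    by (intro integrable_continuous_interval continuous_on_circle_log_plus) auto
  have "integral {0..2*pi} (\<lambda>t. Re (poly q (of_real r * cis t)) powr p)
      \<le> 3 powr p * (integral {0..2*pi} (\<lambda>t. log_plus (cmod (F (cis t))) powr p) + 2 * pi)"
    if r: "0 \<le> r" "r \<le> 1" for r
  proof -
    have "integral {0..2*pi} (\<lambda>t. Re (poly q (of_real r * cis t)) powr p)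
        \<le> integral {0..2*pi} (\<lambda>t. Re (poly q (cis t)) powr p)"
      by (rule power_mean_Re_poly_mono[OF p r pos])
    also have "\<dots> \<le> integral {0..2*pi} (\<lambda>t. 3 powr p * (log_plus (cmod (F (cis t))) powr p + 1))"
    proof (rule integral_le)
      show "(\<lambda>t. Re (poly q (cis t)) powr p) integrable_on {0..2*pi}"
        using pos p
        by (intro integrable_continuous_interval continuous_on_powr' continuous_intros) auto
      show "(\<lambda>t. 3 powr p * (log_plus (cmod (F (cis t))) powr p + 1)) integrable_on {0..2*pi}"
        by (intro integrable_on_mult_right integrable_add int) auto
      fix t
      have "Re (poly q (cis t)) powr p \<le> (log_plus (cmod (F (cis t))) + 1 + 0) powr p"
        using upper[of "cis t"] pos[of "cis t"] p by (intro powr_mono2) auto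
      also have "\<dots> \<le> 3 powr p * (log_plus (cmod (F (cis t))) powr p + 1 powr p + 0 powr p)"
        using p by (intro powr_sum3_le) (auto simp: log_plus_nonneg)
      finally show "Re (poly q (cis t)) powr p \<le> 3 powr p * (log_plus (cmod (F (cis t))) powr p + 1)"
        by simp
    qed
    also have "\<dots> = 3 powr p * (integral {0..2*pi} (\<lambda>t. log_plus (cmod (F (cis t))) powr p) + 2 * pi)"
      by (simp add: integral_add[OF int integrable_const_ivl])
    finally show ?thesis .
  qed
  with pos bd show thesis
    using that unfolding F_def by blast
qed

text \<open>
  The denominator is a limit of \<open>exp (- q n)\<close>, where \<open>Re (q n z)\<close> majorises
  \<open>log_plus \<bar>f(R n * z)\<bar>\<close> on the unit circle and \<open>R n \<rightarrow> 1\<close>. The dilations \<open>f(R n * z)\<close> make \<open>exp (- q n)\<close> and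
  \<open>f(R n * z) * exp (- q n z)\<close> bounded by \<open>1\<close> on the whole disk.
\<close>
lemma bounded_denominator:
  assumes f: "f \<in> nevanlinna_p p" and p: "1 < p"
  obtains h M where "h holomorphic_on unit_disk"
    and "\<And>z. z \<in> unit_disk \<Longrightarrow> h z \<noteq> 0"
    and "\<And>z. z \<in> unit_disk \<Longrightarrow> cmod (h z) \<le> 1"
    and "\<And>z. z \<in> unit_disk \<Longrightarrow> cmod (f z * h z) \<le> 1"
    and "\<And>r. 0 < r \<Longrightarrow> r < 1 \<Longrightarrow>
           integral {0..2*pi} (\<lambda>t. (- ln (cmod (h (of_real r * cis t)))) powr p) \<le> M"
proof -
  have holf: "f holomorphic_on unit_disk"
    using f by (simp add: nevanlinna_p_iff disk_holomorphic_def)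
  obtain C where C: "\<And>r. 0 < r \<Longrightarrow> r < 1 \<Longrightarrow>
      integral {0..2*pi} (\<lambda>t. log_plus (cmod (f (of_real r * cis t))) powr p) \<le> C"
    using f unfolding nevanlinna_p_iff by metis
  define M where "M = 3 powr p * (C + 2 * pi)"
  define R where "R = (\<lambda>n. 1 - 1 / (real n + 2))"
  have R: "0 < R n" "R n < 1" for n
    by (auto simp: R_def field_simps)
  have R_lim: "R \<longlonglongrightarrow> 1"
    unfolding R_def by real_asymp
  have "\<exists>q. (\<forall>z. cmod z \<le> 1 \<longrightarrow> 0 \<le> Re (poly q z)) \<and>
        (\<forall>z. cmod z \<le> 1 \<longrightarrow> cmod (f (of_real (R n) * z) * exp (- poly q z)) \<le> 1) \<and>
        (\<forall>r. 0 \<le> r \<and> r \<le> 1 \<longrightarrow>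
            integral {0..2*pi} (\<lambda>t. Re (poly q (of_real r * cis t)) powr p) \<le> M)" for n
  proof -
    obtain q where q: "\<And>z. cmod z \<le> 1 \<Longrightarrow> 0 \<le> Re (poly q z)"
      "\<And>z. cmod z \<le> 1 \<Longrightarrow> cmod (f (of_real (R n) * z) * exp (- poly q z)) \<le> 1"
      "\<And>r. 0 \<le> r \<Longrightarrow> r \<le> 1 \<Longrightarrow>
          integral {0..2*pi} (\<lambda>t. Re (poly q (of_real r * cis t)) powr p)
          \<le> 3 powr p * (integral {0..2*pi} (\<lambda>t. log_plus (cmod (f (of_real (R n) * cis t))) powr p) + 2 * pi)"
      using harmonic_polynomial_majorant[OF holf R p] by blast
    have "3 powr p * (integral {0..2*pi} (\<lambda>t. log_plus (cmod (f (of_real (R n) * cis t))) powr p) + 2 * pi) \<le> M"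
      unfolding M_def using C[OF R] by (intro mult_left_mono) auto
    with q(3) have "\<forall>r. 0 \<le> r \<and> r \<le> 1 \<longrightarrow>
        integral {0..2*pi} (\<lambda>t. Re (poly q (of_real r * cis t)) powr p) \<le> M"
      using order_trans by blast
    with q(1,2) show ?thesis by blast
  qed
  then obtain q where pos: "\<And>n z. cmod z \<le> 1 \<Longrightarrow> 0 \<le> Re (poly (q n) z)"
    and bd: "\<And>n z. cmod z \<le> 1 \<Longrightarrow> cmod (f (of_real (R n) * z) * exp (- poly (q n) z)) \<le> 1"
    and mean: "\<And>n r. 0 \<le> r \<Longrightarrow> r \<le> 1 \<Longrightarrow>
            integral {0..2*pi} (\<lambda>t. Re (poly (q n) (of_real r * cis t)) powr p) \<le> M"
    by metis
  define H where "H = (\<lambda>n z. exp (- poly (q n) z))"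
  have norm_H: "cmod (H n z) = exp (- Re (poly (q n) z))" for n z
    by (simp add: H_def)
  have H_le: "cmod (H n z) \<le> 1" if "cmod z \<le> 1" for n z
    using pos[OF that] by (simp add: norm_H)
  have H_hol: "H n holomorphic_on A" for n A
    unfolding H_def by (intro holomorphic_intros)
  have H_hol_disk: "g holomorphic_on unit_disk" if "g \<in> range H" for g
    using that H_hol by auto
  have H_bounded: "\<exists>B. \<forall>g\<in>range H. \<forall>z\<in>K. cmod (g z) \<le> B" if "K \<subseteq> unit_disk" for K
    using that H_le by (intro exI[of _ 1]) (auto simp: subset_iff less_imp_le)
  obtain h s where h: "h holomorphic_on unit_disk" and s: "strict_mono (s :: nat \<Rightarrow> nat)"
    and lim: "\<And>z. z \<in> unit_disk \<Longrightarrow> (\<lambda>n. H (s n) z) \<longlonglongrightarrow> h z"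
    and unif: "\<And>K. compact K \<Longrightarrow> K \<subseteq> unit_disk \<Longrightarrow> uniform_limit K (H \<circ> s) h sequentially"
  proof (rule Montel[OF open_ball H_hol_disk H_bounded subset_refl])
    fix g and r :: "nat \<Rightarrow> nat"
    assume a: "g holomorphic_on unit_disk" "strict_mono r"
    assume b: "\<And>x. x \<in> unit_disk \<Longrightarrow> (\<lambda>n. H (r n) x) \<longlonglongrightarrow> g x"
    assume c: "\<And>K. compact K \<Longrightarrow> K \<subseteq> unit_disk \<Longrightarrow> uniform_limit K (H \<circ> r) g sequentially"
    show thesis
      by (rule that[OF a b c])
  qed
  \<comment> \<open>The mean bound for radius \<open>0\<close> bounds \<open>Re (q n)\<close> at the centre, so the limit does not vanish there.\<close>
  define B where "B = (M / (2 * pi)) powr (1 / p)"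
  have "Re (poly (q n) 0) \<le> B" for n
  proof -
    have "Re (poly (q n) 0) powr p \<le> M / (2 * pi)"
      using mean[of 0 n] by (simp add: field_simps)
    then have "(Re (poly (q n) 0) powr p) powr (1 / p) \<le> B"
      unfolding B_def using p by (intro powr_mono2) auto
    then show ?thesis
      using p pos[of 0 n] by (simp add: powr_powr)
  qed
  then have "exp (- B) \<le> cmod (H n 0)" for n
    by (simp add: norm_H)
  moreover have "(\<lambda>n. cmod (H (s n) 0)) \<longlonglongrightarrow> cmod (h 0)"
    by (intro tendsto_norm lim) simp
  ultimately have "exp (- B) \<le> cmod (h 0)"
    by (intro LIMSEQ_le_const) auto
  then have h0: "h 0 \<noteq> 0"
    using exp_gt_zero[of "- B"] by (auto simp del: exp_gt_zero)
  have h_nz: "h z \<noteq> 0" if z: "z \<in> unit_disk" for z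
  proof (cases "h constant_on unit_disk")
    case True
    then show ?thesis using h0 z unfolding constant_on_def by (metis centre_in_ball zero_less_one)
  next
    case False
    show ?thesis
      by (rule Hurwitz_no_zeros[OF _ _ _ h unif False _ z])
         (use H_hol in \<open>auto simp: H_def\<close>)
  qed
  have h_le: "cmod (h z) \<le> 1" if z: "z \<in> unit_disk" for z
    using z H_le by (intro LIMSEQ_le_const2[OF tendsto_norm[OF lim[OF z]]]) auto
  have fh_le: "cmod (f z * h z) \<le> 1" if z: "z \<in> unit_disk" for z
  proof -
    have "isCont f z"
      using holomorphic_on_imp_continuous_on[OF holf] z
      by (simp add: continuous_on_eq_continuous_at)
    moreover have "(\<lambda>n. of_real (R (s n)) * z) \<longlonglongrightarrow> of_real 1 * z"
      by (intro tendsto_intros LIMSEQ_subseq_LIMSEQ[OF R_lim s, unfolded o_def])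
    ultimately have "(\<lambda>n. f (of_real (R (s n)) * z)) \<longlonglongrightarrow> f z"
      by (auto intro: isCont_tendsto_compose)
    then have "(\<lambda>n. cmod (f (of_real (R (s n)) * z) * H (s n) z)) \<longlonglongrightarrow> cmod (f z * h z)"
      by (intro tendsto_intros lim z)
    then show ?thesis
      using bd[of z] z by (intro LIMSEQ_le_const2) (auto simp: H_def)
  qed
  have "integral {0..2*pi} (\<lambda>t. (- ln (cmod (h (of_real r * cis t)))) powr p) \<le> M"
    if r: "0 < r" "r < 1" for r
  proof -
    have sub: "sphere 0 r \<subseteq> unit_disk" using r by auto
    have "\<exists>z\<in>sphere 0 r. \<forall>w\<in>sphere 0 r. cmod (h z) \<le> cmod (h w)"
      using r h sub
      by (intro continuous_attains_inf continuous_on_norm holomorphic_on_imp_continuous_on)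
         (auto intro: holomorphic_on_subset)
    then obtain z0 where z0: "z0 \<in> sphere 0 r" "\<And>w. w \<in> sphere 0 r \<Longrightarrow> cmod (h z0) \<le> cmod (h w)"
      by blast
    \<comment> \<open>Since \<open>\<bar>h\<bar> \<ge> 2 * d > 0\<close> on this circle, uniform convergence gives \<open>Re q \<le> - ln d\<close> there for
      all late terms; this constant is the integrable bound for dominated convergence.\<close>
    define d where "d = cmod (h z0) / 2"
    have d: "0 < d" using h_nz z0(1) sub by (auto simp: d_def)
    have "\<forall>\<^sub>F n in sequentially. \<forall>w\<in>sphere 0 r. dist (H (s n) w) (h w) < d"
      using uniform_limitD[OF unif[OF compact_sphere sub] d] by (simp add: o_def)
    then obtain N where N: "\<And>n w. n \<ge> N \<Longrightarrow> w \<in> sphere 0 r \<Longrightarrow> dist (H (s n) w) (h w) < d"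
      unfolding eventually_sequentially by blast
    define u where "u = (\<lambda>n t. Re (poly (q (s (n + N))) (of_real r * cis t)))"
    have circ: "of_real r * cis t \<in> sphere 0 r" for t
      using r by (simp add: norm_mult)
    have u_nonneg: "0 \<le> u n t" for n t
      unfolding u_def using r by (intro pos) (simp add: norm_mult)
    have u_ln: "u n t = - ln (cmod (H (s (n + N)) (of_real r * cis t)))" for n t
      by (simp add: u_def norm_H)
    have u_le: "u n t \<le> - ln d" for n t
    proof -
      let ?w = "of_real r * cis t"
      have "2 * d \<le> cmod (h ?w)" using z0(2)[OF circ] by (simp add: d_def)
      moreover have "cmod (h ?w) - cmod (H (s (n + N)) ?w) < d"
        using N[of "n + N" ?w] circ norm_triangle_ineq2[of "h ?w" "H (s (n + N)) ?w"]
        by (simp add: dist_norm norm_minus_commute)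
      ultimately have "d \<le> cmod (H (s (n + N)) ?w)" by simp
      then show ?thesis
        unfolding u_ln using d ln_le_cancel_iff[of d "cmod (H (s (n + N)) ?w)"] by linarith
    qed
    have u_lim: "(\<lambda>n. u n t) \<longlonglongrightarrow> - ln (cmod (h (of_real r * cis t)))" for t
    proof -
      have *: "of_real r * cis t \<in> unit_disk" using circ sub by blast
      show ?thesis
        unfolding u_ln
        using h_nz[OF *] by (intro tendsto_intros LIMSEQ_ignore_initial_segment lim *) auto
    qed
    have "(\<lambda>n. integral {0..2*pi} (\<lambda>t. u n t powr p))
        \<longlonglongrightarrow> integral {0..2*pi} (\<lambda>t. (- ln (cmod (h (of_real r * cis t)))) powr p)"
    proof (rule dominated_convergence(2))
      show "(\<lambda>t. u n t powr p) integrable_on {0..2*pi}" for n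
        using u_nonneg p unfolding u_def
        by (intro integrable_continuous_interval continuous_on_powr' continuous_intros) auto
      show "(\<lambda>t. (- ln d) powr p) integrable_on {0..2*pi}" by auto
      show "norm (u n t powr p) \<le> (- ln d) powr p" for n t
        using u_le u_nonneg p by (auto intro!: powr_mono2)
      show "(\<lambda>n. u n t powr p) \<longlonglongrightarrow> (- ln (cmod (h (of_real r * cis t)))) powr p" for t
        using p by (intro tendsto_powr' u_lim tendsto_const) (auto simp: u_nonneg)
    qed
    then show ?thesis
      using mean[of r] r by (intro LIMSEQ_le_const2) (auto simp: u_def)
  qed
  with that h h_nz h_le fh_le show thesis by blast
qed

theorem theoremB:
  fixes p :: real
  assumes "1 < p"
  shows "nevanlinna_smirnov_type (nevanlinna_p p)"
  unfolding nevanlinna_smirnov_type_def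
proof (intro conjI ballI)
  show "cring (pointwise_ring (nevanlinna_p p))"
    using assms by (intro cring_nevanlinna_p) simp
  show H_sub: "H_infinity \<subseteq> nevanlinna_p p"
    using assms by (intro H_infinity_subset_nevanlinna_p) simp
  show "nevanlinna_p p \<subseteq> nevanlinna"
    using assms nevanlinna_p_antimono[of 1 p] by (simp add: nevanlinna_eq_nevanlinna_p_1)
  fix f assume f: "f \<in> nevanlinna_p p"
  obtain h M where hol: "h holomorphic_on unit_disk"
    and nz: "\<And>z. z \<in> unit_disk \<Longrightarrow> h z \<noteq> 0"
    and le: "\<And>z. z \<in> unit_disk \<Longrightarrow> cmod (h z) \<le> 1"
    and fh: "\<And>z. z \<in> unit_disk \<Longrightarrow> cmod (f z * h z) \<le> 1"
    and mean: "\<And>r. 0 < r \<Longrightarrow> r < 1 \<Longrightarrow>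
           integral {0..2*pi} (\<lambda>t. (- ln (cmod (h (of_real r * cis t)))) powr p) \<le> M"
    using bounded_denominator[OF f assms] by blast
  have f_hol: "f holomorphic_on unit_disk" and f_ext: "f \<in> extensional unit_disk"
    using f by (auto simp: nevanlinna_p_iff disk_holomorphic_def)
  let ?h = "\<lambda>z\<in>unit_disk. h z"
  let ?g = "\<lambda>z\<in>unit_disk. f z * h z"
  let ?k = "\<lambda>z\<in>unit_disk. 1 / h z"
  have h_in: "?h \<in> H_infinity"
    unfolding H_infinity_def using le hol
    by (auto intro!: disk_holomorphic_restrict boundedI[of _ 1])
  have g_in: "?g \<in> H_infinity"
    unfolding H_infinity_def using fh hol f_hol
    by (auto intro!: disk_holomorphic_restrict boundedI[of _ 1] holomorphic_intros)
  have "?k \<in> disk_holomorphic"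
    by (intro disk_holomorphic_restrict holomorphic_intros hol nz)
  moreover have "log_plus (cmod (?k z)) = - ln (cmod (h z))" if z: "z \<in> unit_disk" for z
  proof -
    have "0 < cmod (h z)" "ln (cmod (h z)) \<le> 0" using le[OF z] nz[OF z] by simp_all
    then show ?thesis using z nz[OF z] by (simp add: log_plus_def norm_divide ln_div)
  qed
  then have "integral {0..2*pi} (\<lambda>t. log_plus (cmod (?k (of_real r * cis t))) powr p) \<le> M"
    if "0 < r" "r < 1" for r
    using mean[OF that] that by (simp add: norm_mult del: restrict_apply)
  ultimately have k_in: "?k \<in> nevanlinna_p p"
    unfolding nevanlinna_p_iff by blast
  have "?h \<in> Units (pointwise_ring (nevanlinna_p p))"
    unfolding Units_def pointwise_ring_def
    using h_in H_sub k_in nz by (auto intro!: bexI[OF _ k_in] restrict_ext)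
  moreover have "f = (\<lambda>z\<in>unit_disk. ?g z / ?h z)"
    by (rule extensional_restrict_eq[symmetric, OF f_ext]) (simp add: nz)
  ultimately show "\<exists>g\<in>H_infinity. \<exists>h\<in>H_infinity.
      h \<in> Units (pointwise_ring (nevanlinna_p p)) \<and> f = (\<lambda>z\<in>unit_disk. g z / h z)"
    using g_in h_in by blast
qed

end
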